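(* For all integers $n\ge 0$ and $r,\lambda\ge 1$, $$\tilde B_r^\lambda(1;n)=\sum_{k=0}^{n}\sum_{i=k}^{n}\binom{n}{i}\,\mathcal{W}_{2,r-1}(i,k)\,\lambda^k.$$
   Context: For integers $m\ge 1$ and $r,n,k\ge 0$, the $r$-Whitney numbers of the second kind are $$\mathcal{W}_{m,r}(n,k)=\frac{1}{m^k k!}\sum_{t=0}^{k}(-1)^t\binom{k}{t}\,[m(k-t)+r]^n,$$ with the convention $0^0=1$. For integers $n,r\ge 0$, $\lambda\ge 1$, $\tilde B_r^\lambda(1;n)$ denotes the number of configurations on $[n+r]=\{1,\dots,n+r\}$ of the following kind: the first $r$ elements form $r$ singleton blocks (the distinguishable blocks); the elements $r+1,\dots,n+r$ are partitioned into $k$ non-empty subsets, where $k$ runs over $0,\dots,n$ (all $k$ are counted); each of these $k$ subsets either is placed into one of $\lambda$ labelled sections or is paired up with one of the $r$ singletons, each singleton being paired with at most one subset; and, among the subsets placed in the same section, each subset is either paired with exactly one other subset of that section or is not paired at all (i.e. a matching on the subsets in each section). Subsets within a section are unordered. *)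

theory Defs
  imports Complex_Main "HOL-Library.FuncSet" "HOL-Library.Disjoint_Sets"
begin

text \<open>The \<open>r\<close>-Whitney numbers of the second kind, for \<open>m \<ge> 1\<close>.  The subtraction on naturals is
  exact because \<open>t \<le> k\<close>, and \<open>0 ^ 0 = 1\<close> as required.\<close>

definition r_whitney2 :: "nat \<Rightarrow> nat \<Rightarrow> nat \<Rightarrow> nat \<Rightarrow> real" where
  "r_whitney2 m r n k =
     1 / (real m ^ k * fact k) *
       (\<Sum>t = 0..k. (-1) ^ t * real (k choose t) * real (m * (k - t) + r) ^ n)"

definition singleton_blocks :: "nat \<Rightarrow> nat set set" where
  "singleton_blocks r = (\<lambda>j. {j}) ` {1..r}"

datatype placement = Section nat | PairedWith "nat set"

definition placements :: "nat \<Rightarrow> nat \<Rightarrow> placement set" where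
  "placements r l = Section ` {1..l} \<union> PairedWith ` singleton_blocks r"

text \<open>A placement function on the collection \<open>P\<close> of subsets is extensional (\<open>undefined\<close> outside
  \<open>P\<close>), so that each assignment is counted exactly once.\<close>

definition valid_placement ::
    "nat \<Rightarrow> nat \<Rightarrow> nat set set \<Rightarrow> (nat set \<Rightarrow> placement) \<Rightarrow> bool" where
  "valid_placement r l P f \<longleftrightarrow>
     f \<in> P \<rightarrow>\<^sub>E placements r l \<and>
     (\<forall>D \<in> singleton_blocks r. \<forall>A \<in> P. \<forall>B \<in> P.
        f A = PairedWith D \<and> f B = PairedWith D \<longrightarrow> A = B)"

text \<open>The matchings of all sections together: a set of pairwise disjoint unordered pairs of
  distinct subsets, the two members of each pair lying in the same section.\<close>

definition section_matching ::
    "nat set set \<Rightarrow> (nat set \<Rightarrow> placement) \<Rightarrow> nat set set set \<Rightarrow> bool" where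
  "section_matching P f M \<longleftrightarrow>
     (\<forall>e \<in> M. \<exists>A \<in> P. \<exists>B \<in> P. \<exists>s. e = {A, B} \<and> A \<noteq> B \<and> f A = Section s \<and> f B = Section s) \<and>
     disjoint M"

text \<open>The first \<open>r\<close> elements always form the singleton blocks, so a configuration on
  \<open>{1..n + r}\<close> is determined by the partition \<open>P\<close> of the other \<open>n\<close> elements, the placement of the
  members of \<open>P\<close>, and the matchings.  The number \<open>k = card P\<close> of subsets is left free; it ranges
  over \<open>0, \<dots>, n\<close>.\<close>

definition configurations ::
    "nat \<Rightarrow> nat \<Rightarrow> nat \<Rightarrow> (nat set set \<times> (nat set \<Rightarrow> placement) \<times> nat set set set) set" where
  "configurations r l n =
     {(P, f, M). partition_on {r + 1..n + r} P \<and> valid_placement r l P f \<and> section_matching P f M}"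

definition B_tilde :: "nat \<Rightarrow> nat \<Rightarrow> nat \<Rightarrow> nat" where
  "B_tilde r l n = card (configurations r l n)"

lemma finite_configurations: "finite (configurations r l n)"
proof -
  let ?A = "{r + 1..n + r}"
  have fin_places: "finite (placements r l)"
    by (simp add: placements_def singleton_blocks_def)
  have "configurations r l n \<subseteq>
      (SIGMA P : Pow (Pow ?A). (P \<rightarrow>\<^sub>E placements r l) \<times> Pow (Pow P))"
    unfolding configurations_def valid_placement_def section_matching_def partition_on_def
    by fastforce
  moreover have "finite (SIGMA P : Pow (Pow ?A). (P \<rightarrow>\<^sub>E placements r l) \<times> Pow (Pow P))"
    by (intro finite_SigmaI finite_cartesian_product finite_PiE)
       (auto intro: fin_places finite_subset)
  ultimately show ?thesis
    by (rule finite_subset)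
qed

end

theory Submission
  imports Defs
begin

text \<open>
  Write \<open>a\<^sub>r(n)\<close> for the number of configurations with \<open>r\<close> singleton blocks and \<open>n\<close> further
  elements, with \<open>\<lambda>\<close> sections.  The proof rests on the recurrence
  \<open>a\<^sub>r(n + 1) = r a\<^sub>r(n) + \<lambda> a\<^sub>r\<^sub>+\<^sub>2(n)\<close>.  Consider the block of the new element \<open>x\<close>.  If it is
  paired with one of the \<open>r\<close> singletons, delete \<open>x\<close>: what is left of the block, possibly nothing, is
  still attached to that singleton, and this is an arbitrary configuration on the other elements.
  If the block lies in one of the \<open>\<lambda>\<close> sections, then the rest of the block and its partner in the
  matching, either of which may be empty, are sets that could just as well be attached to two
  additional singletons.

  Both halves of this argument are instances of one principle.  Attaching a possibly empty set to
  an additional singleton turns the count into a sum over all subsets \<open>B\<close> of the element set \<open>A\<close>, of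
  the numbers of configurations on \<open>A - B\<close> (\<open>card_arrangements_insert_label\<close>).  Choosing the block of
  \<open>x\<close> and its partner gives sums of the same shape (\<open>card_arrangements_insert_element\<close>), so the
  recurrence follows by comparison and no bijection has to modify a block.  All that is needed is
  that removing some complete blocks, closed under partners, from a configuration is reversible
  (\<open>card_arrangements_extending\<close>).

  On the other side, the explicit formula gives
  \<open>W\<^sub>2\<^sub>,\<^sub>r(n + 1, k) = r W\<^sub>2\<^sub>,\<^sub>r(n, k) + W\<^sub>2\<^sub>,\<^sub>r\<^sub>+\<^sub>2(n, k - 1)\<close>, so that the polynomial
  \<open>\<Sum>\<^sub>k W\<^sub>2\<^sub>,\<^sub>r(n, k) \<lambda>\<^sup>k\<close> satisfies the recurrence of \<open>a\<^sub>r(n)\<close> with the same initial value \<open>1\<close>.  Finally, the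
  binomial theorem writes \<open>W\<^sub>2\<^sub>,\<^sub>r\<close> as the binomial transform of \<open>W\<^sub>2\<^sub>,\<^sub>r\<^sub>-\<^sub>1\<close>, which produces the double sum.
  In terms of exponential generating functions, both sides are
  \<open>exp (r z) exp (\<lambda> (exp (2 z) - 1) / 2)\<close>, the recurrence is the differential equation for it, and the
  binomial transform splits off one factor \<open>exp z\<close>.
\<close>

section \<open>Whitney numbers\<close>

text \<open>The binomial theorem, applied to each power \<open>(m (k - t) + r + 1)\<^sup>n\<close> of the alternating sum.\<close>

lemma r_whitney2_shift:
  "r_whitney2 m (Suc r) n k = (\<Sum>i = 0..n. real (n choose i) * r_whitney2 m r i k)"
proof -
  have "(\<Sum>i = 0..n. real (n choose i) * r_whitney2 m r i k) =
      1 / (real m ^ k * fact k) * (\<Sum>i = 0..n. \<Sum>t = 0..k.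
        (-1) ^ t * real (k choose t) * (real (n choose i) * real (m * (k - t) + r) ^ i))"
    unfolding r_whitney2_def by (simp add: sum_distrib_left mult_ac)
  also have "\<dots> = 1 / (real m ^ k * fact k) * (\<Sum>t = 0..k. \<Sum>i = 0..n.
        (-1) ^ t * real (k choose t) * (real (n choose i) * real (m * (k - t) + r) ^ i))"
    by (subst sum.swap) simp
  also have "\<dots> = 1 / (real m ^ k * fact k) * (\<Sum>t = 0..k.
        (-1) ^ t * real (k choose t) * real (m * (k - t) + Suc r) ^ n)"
  proof -
    have "(\<Sum>i = 0..n. real (n choose i) * x ^ i) = (x + 1) ^ n" for x :: real
      by (simp add: binomial_ring atMost_atLeast0)
    then have "(\<Sum>i = 0..n. real (n choose i) * real (m * (k - t) + r) ^ i)
        = real (m * (k - t) + Suc r) ^ n" for t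
      by (metis add_Suc_right of_nat_Suc add.commute)
    then show ?thesis by (simp only: sum_distrib_left[symmetric])
  qed
  finally show ?thesis by (simp add: r_whitney2_def)
qed

lemma r_whitney2_Suc_0: "r_whitney2 m r (Suc n) 0 = real r * r_whitney2 m r n 0"
  by (simp add: r_whitney2_def)

text \<open>One factor \<open>m (k + 1 - t) + r\<close> is split off each power.  The summand \<open>r\<close> reproduces the sum for
  \<open>n\<close>.  The other one is absorbed by the binomial coefficient, which lowers \<open>k + 1\<close> to \<open>k\<close>; the base
  \<open>m (k + 1 - t) + r\<close> then reads \<open>m (k - t) + (r + m)\<close>.\<close>

lemma r_whitney2_Suc_Suc:
  assumes "m \<ge> 1"
  shows "r_whitney2 m r (Suc n) (Suc k) =
    real r * r_whitney2 m r n (Suc k) + r_whitney2 m (r + m) n k"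
proof -
  define c :: "nat \<Rightarrow> real" where "c k = 1 / (real m ^ k * fact k)" for k
  define y where "y t = real (m * (Suc k - t) + r) ^ n" for t
  have summand: "real (Suc k choose t) * real (Suc k - t) = real (Suc k) * real (k choose t)" for t
    using arg_cong[OF binomial_absorb_comp[of "Suc k" t], of real]
    by (simp only: of_nat_mult mult.commute diff_Suc_1)
  have "(\<Sum>t = 0..Suc k. (-1) ^ t * real (Suc k choose t) * (real (m * (Suc k - t)) * y t))
      = (\<Sum>t = 0..Suc k. real (m * Suc k) * ((-1) ^ t * real (k choose t) * y t))"
  proof (rule sum.cong[OF refl])
    fix t
    have "(-1) ^ t * real (Suc k choose t) * (real (m * (Suc k - t)) * y t)
      = real m * (-1) ^ t * (real (Suc k choose t) * real (Suc k - t)) * y t"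
      by (simp only: of_nat_mult mult_ac)
    then show "(-1) ^ t * real (Suc k choose t) * (real (m * (Suc k - t)) * y t)
      = real (m * Suc k) * ((-1) ^ t * real (k choose t) * y t)"
      by (simp only: summand of_nat_mult mult_ac)
  qed
  also have "\<dots> = real (m * Suc k) * (\<Sum>t = 0..k. (-1) ^ t * real (k choose t) * y t)"
    by (simp add: sum_distrib_left)
  also have "(\<Sum>t = 0..k. (-1) ^ t * real (k choose t) * y t) =
      (\<Sum>t = 0..k. (-1) ^ t * real (k choose t) * real (m * (k - t) + (r + m)) ^ n)"
  proof (rule sum.cong[OF refl])
    fix t assume "t \<in> {0..k}"
    then have "m * (Suc k - t) + r = m * (k - t) + (r + m)" by (simp add: Suc_diff_le)
    then show "(-1) ^ t * real (k choose t) * y t =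
        (-1) ^ t * real (k choose t) * real (m * (k - t) + (r + m)) ^ n"
      by (simp only: y_def)
  qed
  finally have absorbed:
    "c (Suc k) * (\<Sum>t = 0..Suc k. (-1) ^ t * real (Suc k choose t) * (real (m * (Suc k - t)) * y t))
      = c (Suc k) * real (m * Suc k) *
        (\<Sum>t = 0..k. (-1) ^ t * real (k choose t) * real (m * (k - t) + (r + m)) ^ n)"
    by simp
  have "c (Suc k) * real (m * Suc k) = c k"
    using assms by (simp add: c_def field_simps del: of_nat_Suc mult_Suc_right)
  with absorbed have absorbed':
    "c (Suc k) * (\<Sum>t = 0..Suc k. (-1) ^ t * real (Suc k choose t) * (real (m * (Suc k - t)) * y t))
      = r_whitney2 m (r + m) n k"
    by (simp only: r_whitney2_def c_def)
  have "r_whitney2 m r (Suc n) (Suc k) = c (Suc k) *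
      (\<Sum>t = 0..Suc k. real r * ((-1) ^ t * real (Suc k choose t) * y t)
        + (-1) ^ t * real (Suc k choose t) * (real (m * (Suc k - t)) * y t))"
    unfolding r_whitney2_def c_def[symmetric]
    by (intro arg_cong[where f = "\<lambda>s. c (Suc k) * s"] sum.cong refl)
      (simp add: y_def algebra_simps)
  also have "\<dots> = real r * (c (Suc k) * (\<Sum>t = 0..Suc k. (-1) ^ t * real (Suc k choose t) * y t))
      + r_whitney2 m (r + m) n k"
    unfolding sum.distrib distrib_left absorbed' by (simp only: sum_distrib_left[symmetric] mult_ac)
  finally show ?thesis by (simp only: r_whitney2_def c_def y_def)
qed

lemma r_whitney2_eq_0:
  assumes "m \<ge> 1"
  shows "n < k \<Longrightarrow> r_whitney2 m r n k = 0"
proof (induction n arbitrary: r k)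
  case 0
  then show ?case
    using choose_alternating_sum[of k, where ?'a = real]
    by (simp add: r_whitney2_def atMost_atLeast0)
next
  case (Suc n)
  then obtain k' where "k = Suc k'" by (cases k) auto
  with Suc show ?case by (simp add: r_whitney2_Suc_Suc[OF assms])
qed

lemma r_whitney2_0_0: "r_whitney2 m r 0 0 = 1"
  by (simp add: r_whitney2_def)

lemma r_whitney2_polynomial_Suc:
  assumes "m \<ge> 1"
  shows "(\<Sum>k = 0..Suc n. r_whitney2 m r (Suc n) k * x ^ k) =
    real r * (\<Sum>k = 0..n. r_whitney2 m r n k * x ^ k)
      + x * (\<Sum>k = 0..n. r_whitney2 m (r + m) n k * x ^ k)"
proof -
  have "(\<Sum>k = 0..Suc n. r_whitney2 m r (Suc n) k * x ^ k) =
     real r * (r_whitney2 m r n 0 + (\<Sum>k = 0..n. r_whitney2 m r n (Suc k) * x ^ Suc k))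
      + x * (\<Sum>k = 0..n. r_whitney2 m (r + m) n k * x ^ k)"
    by (subst sum.atLeast0_atMost_Suc_shift)
      (simp add: r_whitney2_Suc_0 r_whitney2_Suc_Suc[OF assms] algebra_simps sum.distrib
        sum_distrib_left)
  also have "r_whitney2 m r n 0 + (\<Sum>k = 0..n. r_whitney2 m r n (Suc k) * x ^ Suc k)
      = (\<Sum>k = 0..Suc n. r_whitney2 m r n k * x ^ k)"
    by (subst sum.atLeast0_atMost_Suc_shift) simp
  also have "\<dots> = (\<Sum>k = 0..n. r_whitney2 m r n k * x ^ k)"
    by (simp add: r_whitney2_eq_0[OF assms])
  finally show ?thesis .
qed

section \<open>Removing blocks\<close>

text \<open>The configurations over an arbitrary set \<open>A\<close> of elements, with an arbitrary set \<open>R\<close> of labels in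
  place of the singleton blocks and \<open>L\<close> of sections.  The induction takes elements and labels away
  one by one and must not be tied to initial segments of the natural numbers; the labels are mere
  names here and may overlap with \<open>A\<close>.\<close>

definition arrangements ::
  "nat set \<Rightarrow> nat set set \<Rightarrow> nat set \<Rightarrow>
    (nat set set \<times> (nat set \<Rightarrow> placement) \<times> nat set set set) set" where
  "arrangements A R L = {(P, f, M). partition_on A P \<and>
     f \<in> P \<rightarrow>\<^sub>E Section ` L \<union> PairedWith ` R \<and>
     (\<forall>D. \<forall>B \<in> P. \<forall>C \<in> P. f B = PairedWith D \<and> f C = PairedWith D \<longrightarrow> B = C) \<and>
     section_matching P f M}"

lemma configurations_eq_arrangements:
  "configurations r l n = arrangements {r + 1..n + r} (singleton_blocks r) {1..l}"
proof -
  have "(\<forall>D \<in> R. \<forall>A \<in> P. \<forall>B \<in> P. f A = PairedWith D \<and> f B = PairedWith D \<longrightarrow> A = B) \<longleftrightarrow>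
      (\<forall>D. \<forall>A \<in> P. \<forall>B \<in> P. f A = PairedWith D \<and> f B = PairedWith D \<longrightarrow> A = B)"
    if "f \<in> P \<rightarrow>\<^sub>E Section ` L \<union> PairedWith ` R"
    for f :: "nat set \<Rightarrow> placement" and P R L
    using that by (auto simp: PiE_iff) (metis image_iff placement.distinct(1) placement.inject(2))+
  then show ?thesis
    unfolding configurations_def arrangements_def valid_placement_def placements_def by blast
qed

lemma finite_arrangements:
  assumes "finite A" "finite R" "finite L"
  shows "finite (arrangements A R L)"
proof (rule finite_subset)
  let ?T = "Section ` L \<union> PairedWith ` R"
  show "arrangements A R L \<subseteq> (SIGMA P : Pow (Pow A). (P \<rightarrow>\<^sub>E ?T) \<times> Pow (Pow P))"
    unfolding arrangements_def section_matching_def partition_on_def by fastforce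
  show "finite (SIGMA P : Pow (Pow A). (P \<rightarrow>\<^sub>E ?T) \<times> Pow (Pow P))"
    using assms by (intro finite_SigmaI finite_cartesian_product finite_PiE)
      (auto intro: finite_subset)
qed

lemma arrangements_empty: "arrangements {} R L = {({}, \<lambda>_. undefined, {})}"
  unfolding arrangements_def partition_on_empty
  by (auto simp: section_matching_def disjoint_def)

lemma section_matchingE:
  assumes "section_matching P f M" "e \<in> M"
  obtains B C s where "e = {B, C}" "B \<noteq> C" "B \<in> P" "C \<in> P" "f B = Section s" "f C = Section s"
  using assms unfolding section_matching_def by meson

lemma section_matching_Un:
  assumes "section_matching Q g N" "section_matching P f M" "Q \<inter> P = {}"
  shows "section_matching (Q \<union> P) (\<lambda>B. if B \<in> Q then g B else f B) (N \<union> M)"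
proof -
  let ?h = "\<lambda>B. if B \<in> Q then g B else f B"
  have sub: "e \<subseteq> Q" if "e \<in> N" for e
    using section_matchingE[OF assms(1) that] by (metis empty_subsetI insert_subset)
  have sub': "e \<subseteq> P" if "e \<in> M" for e
    using section_matchingE[OF assms(2) that] by (metis empty_subsetI insert_subset)
  have "disjoint N" "disjoint M"
    using assms by (auto simp: section_matching_def)
  moreover have "\<Union>N \<inter> \<Union>M = {}"
    using sub sub' assms(3) by blast
  ultimately have "disjoint (N \<union> M)"
    by (rule disjoint_union)
  moreover have "\<exists>A \<in> Q \<union> P. \<exists>B \<in> Q \<union> P. \<exists>s. e = {A, B} \<and> A \<noteq> B \<and> ?h A = Section s \<and> ?h B = Section s"
    if e: "e \<in> N \<union> M" for e
  proof (cases "e \<in> N")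
    case True
    then obtain B C s where "e = {B, C}" "B \<noteq> C" "B \<in> Q" "C \<in> Q" "g B = Section s" "g C = Section s"
      by (rule section_matchingE[OF assms(1)])
    then show ?thesis by auto
  next
    case False
    with e have "e \<in> M" by simp
    then obtain B C s where "e = {B, C}" "B \<noteq> C" "B \<in> P" "C \<in> P" "f B = Section s" "f C = Section s"
      by (rule section_matchingE[OF assms(2)])
    moreover from this have "B \<notin> Q" "C \<notin> Q" using assms(3) by auto
    ultimately show ?thesis by auto
  qed
  ultimately show ?thesis unfolding section_matching_def by blast
qed

lemma section_matching_Diff:
  assumes "section_matching P f M"
  shows "section_matching (P - Q) (restrict f (P - Q)) (M - {e \<in> M. e \<inter> Q \<noteq> {}})"
proof -
  let ?h = "restrict f (P - Q)"
  have "\<exists>A \<in> P - Q. \<exists>B \<in> P - Q. \<exists>s. e = {A, B} \<and> A \<noteq> B \<and> ?h A = Section s \<and> ?h B = Section s"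
    if e: "e \<in> M - {e \<in> M. e \<inter> Q \<noteq> {}}" for e
  proof -
    from e have "e \<in> M" by simp
    then obtain B C s where "e = {B, C}" "B \<noteq> C" "B \<in> P" "C \<in> P" "f B = Section s" "f C = Section s"
      by (rule section_matchingE[OF assms])
    moreover from this e have "B \<notin> Q" "C \<notin> Q" by auto
    ultimately show ?thesis by auto
  qed
  moreover have "disjoint (M - {e \<in> M. e \<inter> Q \<noteq> {}})"
    using assms by (auto simp: section_matching_def disjoint_def)
  ultimately show ?thesis unfolding section_matching_def by blast
qed

text \<open>The arrangements on \<open>A\<close> that contain a given arrangement on \<open>U\<close> as a union of connected
  pieces, that is, with no matching edge leaving it, are determined by what they do on \<open>A - U\<close>.  That
  remainder is an arbitrary arrangement avoiding the labels already in use.\<close>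

lemma card_arrangements_extending:
  assumes sub: "(Q, g, N) \<in> arrangements U R L" and "U \<subseteq> A"
  shows "card {(P, f, M) \<in> arrangements A R L.
      Q \<subseteq> P \<and> (\<forall>B \<in> Q. f B = g B) \<and> {e \<in> M. e \<inter> Q \<noteq> {}} = N} =
    card (arrangements (A - U) (R - {D. PairedWith D \<in> g ` Q}) L)"
proof -
  let ?R = "R - {D. PairedWith D \<in> g ` Q}"
  let ?X = "{(P, f, M) \<in> arrangements A R L.
      Q \<subseteq> P \<and> (\<forall>B \<in> Q. f B = g B) \<and> {e \<in> M. e \<inter> Q \<noteq> {}} = N}"
  let ?remove = "\<lambda>(P, f :: nat set \<Rightarrow> placement, M). (P - Q, restrict f (P - Q), M - N)"
  let ?add = "\<lambda>(P, f, M). (Q \<union> P, \<lambda>B. if B \<in> Q then g B else f B, N \<union> M)"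
  have U: "partition_on U Q" and Q: "section_matching Q g N"
    and g: "g \<in> Q \<rightarrow>\<^sub>E Section ` L \<union> PairedWith ` R"
    and g_inj: "\<And>D B C. B \<in> Q \<Longrightarrow> C \<in> Q \<Longrightarrow> g B = PairedWith D \<Longrightarrow> g C = PairedWith D \<Longrightarrow> B = C"
    using sub by (auto simp: arrangements_def)
  have N_sub: "e \<subseteq> Q \<and> e \<noteq> {}" if "e \<in> N" for e
    using section_matchingE[OF Q that] by (metis empty_subsetI insert_subset insert_not_empty)
  have fresh: "Q \<inter> P = {}" if "partition_on (A - U) P" for P
  proof -
    have "\<Union>Q = U" "\<Union>P = A - U" "{} \<notin> Q" using that U by (auto simp: partition_on_def)
    show ?thesis
    proof (rule ccontr)
      assume "Q \<inter> P \<noteq> {}"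
      then obtain B where "B \<in> Q" "B \<in> P" by auto
      then have "B \<subseteq> U" "B \<subseteq> A - U" "B \<noteq> {}"
        using \<open>\<Union>Q = U\<close> \<open>\<Union>P = A - U\<close> \<open>{} \<notin> Q\<close> by auto
      then show False by blast
    qed
  qed
  have new_edges: "{e \<in> N \<union> M. e \<inter> Q \<noteq> {}} = N" "M \<inter> N = {}"
    if "section_matching P f M" "Q \<inter> P = {}" for P f M
  proof -
    have "e \<subseteq> P" if "e \<in> M" for e
      using section_matchingE[OF \<open>section_matching P f M\<close> that] by (metis empty_subsetI insert_subset)
    then show "{e \<in> N \<union> M. e \<inter> Q \<noteq> {}} = N" "M \<inter> N = {}"
      using N_sub \<open>Q \<inter> P = {}\<close> by blast+
  qed
  have remove: "?remove (P, f, M) \<in> arrangements (A - U) ?R L" if c: "(P, f, M) \<in> ?X" for P f M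
  proof -
    from c have arr: "(P, f, M) \<in> arrangements A R L"
      and QP: "Q \<subseteq> P" "\<And>B. B \<in> Q \<Longrightarrow> f B = g B" "N = {e \<in> M. e \<inter> Q \<noteq> {}}" by auto
    have P: "partition_on A P" using arr by (simp add: arrangements_def)
    have "\<Union>(P - Q) = A - U"
    proof -
      have "disjnt B C" if "B \<in> Q" "C \<in> P - Q" for B C
      proof -
        have "B \<in> P" "C \<in> P" "B \<noteq> C" using that QP(1) by auto
        then show ?thesis using P unfolding partition_on_def disjoint_def disjnt_def by blast
      qed
      moreover have "\<Union>P = A" "\<Union>Q = U" using P U by (auto simp: partition_on_def)
      ultimately show ?thesis by (fastforce simp: disjnt_iff)
    qed
    then have "partition_on (A - U) (P - Q)"
      using P by (auto simp: partition_on_def disjoint_def)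
    moreover have "restrict f (P - Q) \<in> P - Q \<rightarrow>\<^sub>E Section ` L \<union> PairedWith ` ?R"
    proof (rule PiE_I)
      fix B assume B: "B \<in> P - Q"
      then have "f B \<in> Section ` L \<union> PairedWith ` R" using arr by (auto simp: arrangements_def)
      moreover have "PairedWith D \<notin> g ` Q" if "f B = PairedWith D" for D
      proof
        assume "PairedWith D \<in> g ` Q"
        then obtain C where "C \<in> Q" "f C = PairedWith D" using QP(2) by force
        moreover have "B \<in> P" "C \<in> P" using B \<open>C \<in> Q\<close> QP(1) by auto
        ultimately have "B = C" using that arr unfolding arrangements_def by blast
        with B \<open>C \<in> Q\<close> show False by simp
      qed
      ultimately show "restrict f (P - Q) B \<in> Section ` L \<union> PairedWith ` ?R"
        using B by auto
    qed auto
    moreover have "section_matching (P - Q) (restrict f (P - Q)) (M - N)"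
      unfolding QP(3) by (rule section_matching_Diff) (use arr in \<open>simp add: arrangements_def\<close>)
    ultimately show ?thesis
      using arr by (auto simp: arrangements_def)
  qed
  have add: "?add (P, f, M) \<in> ?X" if arr: "(P, f, M) \<in> arrangements (A - U) ?R L" for P f M
  proof -
    let ?h = "\<lambda>B. if B \<in> Q then g B else f B"
    have P: "partition_on (A - U) P" using arr by (simp add: arrangements_def)
    have f: "f \<in> P \<rightarrow>\<^sub>E Section ` L \<union> PairedWith ` ?R" using arr by (simp add: arrangements_def)
    have M: "section_matching P f M" using arr by (simp add: arrangements_def)
    have f_inj: "\<And>D B C. B \<in> P \<Longrightarrow> C \<in> P \<Longrightarrow> f B = PairedWith D \<Longrightarrow> f C = PairedWith D \<Longrightarrow> B = C"
      using arr by (auto simp: arrangements_def)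
    have "partition_on A (Q \<union> P)"
    proof -
      have "disjoint (Q \<union> P)"
        using U P by (intro disjoint_union) (auto simp: partition_on_def)
      then show ?thesis using U P \<open>U \<subseteq> A\<close> by (auto simp: partition_on_def)
    qed
    moreover have "?h \<in> Q \<union> P \<rightarrow>\<^sub>E Section ` L \<union> PairedWith ` R"
      using f g by (auto simp: PiE_iff extensional_def)
    moreover have "B = C"
      if "B \<in> Q \<union> P" "C \<in> Q \<union> P" "?h B = PairedWith D" "?h C = PairedWith D" for B C D
    proof -
      have "PairedWith D \<notin> g ` Q" if "E \<in> P" "f E = PairedWith D" for E
        using PiE_mem[OF f that(1)] that(2) by auto
      then show ?thesis using that f_inj g_inj by (auto split: if_splits) (metis imageI)+
    qed
    moreover have "section_matching (Q \<union> P) ?h (N \<union> M)"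
      using Q M fresh[OF P] by (rule section_matching_Un)
    ultimately show ?thesis
      using new_edges[OF M fresh[OF P]] unfolding arrangements_def by simp
  qed
  have "bij_betw ?remove ?X (arrangements (A - U) ?R L)"
  proof (rule bij_betwI[where g = ?add])
    show "?remove \<in> ?X \<rightarrow> arrangements (A - U) ?R L"
    proof (rule funcsetI)
      fix c assume c: "c \<in> ?X"
      obtain P f M where "c = (P, f, M)" by (cases c)
      with c show "?remove c \<in> arrangements (A - U) ?R L"
        using remove by (simp only:)
    qed
    show "?add \<in> arrangements (A - U) ?R L \<rightarrow> ?X"
    proof (rule funcsetI)
      fix c assume c: "c \<in> arrangements (A - U) ?R L"
      obtain P f M where "c = (P, f, M)" by (cases c)
      with c show "?add c \<in> ?X"
        using add by (simp only:)
    qed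
    show "?add (?remove c) = c" if c: "c \<in> ?X" for c
    proof -
      obtain P f M where c_eq: "c = (P, f, M)" by (cases c)
      from c have QP: "Q \<subseteq> P" "\<And>B. B \<in> Q \<Longrightarrow> f B = g B" "N \<subseteq> M"
        and "f \<in> extensional P"
        unfolding c_eq by (auto simp: arrangements_def PiE_iff)
      then have "(\<lambda>B. if B \<in> Q then g B else restrict f (P - Q) B) = f"
        by (auto simp: fun_eq_iff extensional_def)
      with QP show ?thesis unfolding c_eq by auto
    qed
    show "?remove (?add c) = c" if c: "c \<in> arrangements (A - U) ?R L" for c
    proof -
      obtain P f M where c_eq: "c = (P, f, M)" by (cases c)
      from c have P: "partition_on (A - U) P" and M: "section_matching P f M"
        and f: "f \<in> extensional P"
        unfolding c_eq by (auto simp: arrangements_def PiE_iff)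
      have "Q \<union> P - Q = P" using fresh[OF P] by blast
      moreover have "restrict (\<lambda>B. if B \<in> Q then g B else f B) P = f"
        using f fresh[OF P] by (auto simp: fun_eq_iff extensional_def)
      moreover have "N \<union> M - N = M" using new_edges(2)[OF M fresh[OF P]] by blast
      ultimately show ?thesis unfolding c_eq by simp
    qed
  qed
  then show ?thesis by (rule bij_betw_same_card)
qed

text \<open>A block paired with a label is in no section and hence in no edge of the matching.\<close>

lemma card_arrangements_paired_block:
  assumes "B \<noteq> {}" "B \<subseteq> A" "D \<in> R"
  shows "card {(P, f, M) \<in> arrangements A R L. B \<in> P \<and> f B = PairedWith D} =
    card (arrangements (A - B) (R - {D}) L)"
proof -
  let ?g = "restrict (\<lambda>_. PairedWith D) {B}"
  have "({B}, ?g, {}) \<in> arrangements B R L"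
    using assms by (auto simp: arrangements_def section_matching_def partition_on_def disjoint_def)
  note card_arrangements_extending[OF this assms(2)]
  moreover have "{(P, f, M) \<in> arrangements A R L. B \<in> P \<and> f B = PairedWith D} =
     {(P, f, M) \<in> arrangements A R L.
        {B} \<subseteq> P \<and> (\<forall>C \<in> {B}. f C = ?g C) \<and> {e \<in> M. e \<inter> {B} \<noteq> {}} = {}}"
  proof -
    have "{e \<in> M. e \<inter> {B} \<noteq> {}} = {}"
      if "(P, f, M) \<in> arrangements A R L" "f B = PairedWith D" for P f M
      using that by (fastforce simp: arrangements_def elim: section_matchingE)
    then show ?thesis by auto
  qed
  ultimately show ?thesis by simp
qed

lemma card_arrangements_single_block:
  assumes "B \<noteq> {}" "B \<subseteq> A" "s \<in> L"
  shows "card {(P, f, M) \<in> arrangements A R L. B \<in> P \<and> f B = Section s \<and> B \<notin> \<Union>M} =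
    card (arrangements (A - B) R L)"
proof -
  let ?g = "restrict (\<lambda>_. Section s) {B}"
  have "({B}, ?g, {}) \<in> arrangements B R L"
    using assms by (auto simp: arrangements_def section_matching_def partition_on_def disjoint_def)
  note card_arrangements_extending[OF this assms(2)]
  moreover have "{(P, f, M) \<in> arrangements A R L. B \<in> P \<and> f B = Section s \<and> B \<notin> \<Union>M} =
     {(P, f, M) \<in> arrangements A R L.
        {B} \<subseteq> P \<and> (\<forall>C \<in> {B}. f C = ?g C) \<and> {e \<in> M. e \<inter> {B} \<noteq> {}} = {}}"
    by auto
  ultimately show ?thesis by simp
qed

lemma card_arrangements_matched_blocks:
  assumes "B \<noteq> {}" "C \<noteq> {}" "B \<inter> C = {}" "B \<subseteq> A" "C \<subseteq> A" "s \<in> L"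
  shows "card {(P, f, M) \<in> arrangements A R L. B \<in> P \<and> f B = Section s \<and> {B, C} \<in> M} =
    card (arrangements (A - B - C) R L)"
proof -
  have "B \<noteq> C" using assms by blast
  let ?g = "restrict (\<lambda>_. Section s) {B, C}"
  have "({B, C}, ?g, {{B, C}}) \<in> arrangements (B \<union> C) R L"
  proof -
    have "partition_on (B \<union> C) {B, C}"
      using assms by (auto simp: partition_on_def disjoint_def)
    moreover have "section_matching {B, C} ?g {{B, C}}"
      using \<open>B \<noteq> C\<close> by (auto simp: section_matching_def)
    ultimately show ?thesis
      using assms unfolding arrangements_def by simp
  qed
  moreover have "B \<union> C \<subseteq> A" using assms by blast
  ultimately have "card {(P, f, M) \<in> arrangements A R L. {B, C} \<subseteq> P
        \<and> (\<forall>E \<in> {B, C}. f E = ?g E) \<and> {e \<in> M. e \<inter> {B, C} \<noteq> {}} = {{B, C}}} =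
      card (arrangements (A - (B \<union> C)) (R - {D. PairedWith D \<in> ?g ` {B, C}}) L)"
    by (rule card_arrangements_extending)
  also have "A - (B \<union> C) = A - B - C" by blast
  also have "R - {D. PairedWith D \<in> ?g ` {B, C}} = R" using \<open>B \<noteq> C\<close> by auto
  also have "{(P, f, M) \<in> arrangements A R L. {B, C} \<subseteq> P
        \<and> (\<forall>E \<in> {B, C}. f E = ?g E) \<and> {e \<in> M. e \<inter> {B, C} \<noteq> {}} = {{B, C}}} =
     {(P, f, M) \<in> arrangements A R L. B \<in> P \<and> f B = Section s \<and> {B, C} \<in> M}"
  proof -
    have "{B, C} \<subseteq> P \<and> (\<forall>E \<in> {B, C}. f E = ?g E) \<and> {e \<in> M. e \<inter> {B, C} \<noteq> {}} = {{B, C}}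
        \<longleftrightarrow> B \<in> P \<and> f B = Section s \<and> {B, C} \<in> M"
      if "(P, f, M) \<in> arrangements A R L" for P f M
    proof
      assume r: "B \<in> P \<and> f B = Section s \<and> {B, C} \<in> M"
      have M: "section_matching P f M" using that by (simp add: arrangements_def)
      from r have "{B, C} \<in> M" by simp
      then obtain B' C' s' where "{B, C} = {B', C'}" "B' \<in> P" "C' \<in> P"
          "f B' = Section s'" "f C' = Section s'"
        by (rule section_matchingE[OF M])
      with r have "C \<in> P" "f C = Section s" by (auto simp: doubleton_eq_iff)
      moreover have "e = {B, C}" if "e \<in> M" "e \<inter> {B, C} \<noteq> {}" for e
      proof (rule ccontr)
        assume "e \<noteq> {B, C}"
        with M that(1) r have "e \<inter> {B, C} = {}"
          unfolding section_matching_def by (intro disjointD[of M]) simp_all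
        with that(2) show False by simp
      qed
      ultimately show "{B, C} \<subseteq> P \<and> (\<forall>E \<in> {B, C}. f E = ?g E) \<and>
          {e \<in> M. e \<inter> {B, C} \<noteq> {}} = {{B, C}}"
        using r by auto
    qed (use \<open>B \<noteq> C\<close> in auto)
    then have "(P, f, M) \<in> arrangements A R L \<and> {B, C} \<subseteq> P
        \<and> (\<forall>E \<in> {B, C}. f E = ?g E) \<and> {e \<in> M. e \<inter> {B, C} \<noteq> {}} = {{B, C}} \<longleftrightarrow>
      (P, f, M) \<in> arrangements A R L \<and> B \<in> P \<and> f B = Section s \<and> {B, C} \<in> M" for P f M
      by meson
    then show ?thesis by (simp only:)
  qed
  finally show ?thesis .
qed

section \<open>The recurrence\<close>

text \<open>The set \<open>B\<close> is the block paired with the new label; \<open>B = {}\<close> accounts for the arrangements that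
  leave the label free.\<close>

lemma card_arrangements_insert_label:
  assumes "finite A" "finite R" "finite L" "D \<notin> R"
  shows "card (arrangements A (insert D R) L) = (\<Sum>B \<in> Pow A. card (arrangements (A - B) R L))"
proof -
  let ?arr = "arrangements A (insert D R) L"
  let ?X = "\<lambda>B. {(P, f, M) \<in> ?arr. B \<in> P \<and> f B = PairedWith D}"
  have fin: "finite ?arr" using assms by (intro finite_arrangements) auto
  then have fin_X: "finite (?X B)" for B by (rule rev_finite_subset) auto
  have free: "arrangements A R L = {(P, f, M) \<in> ?arr. \<forall>B \<in> P. f B \<noteq> PairedWith D}"
    using assms(4) unfolding arrangements_def PiE_iff by fastforce
  have "?arr = arrangements A R L \<union> (\<Union>B \<in> Pow A - {{}}. ?X B)"
  proof -
    have "B \<in> Pow A - {{}}" if "(P, f, M) \<in> ?arr" "B \<in> P" for P f M B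
      using that by (auto simp: arrangements_def partition_on_def)
    then have "c \<in> ?arr \<longleftrightarrow> c \<in> arrangements A R L \<union> (\<Union>B \<in> Pow A - {{}}. ?X B)" for c
      unfolding free
      by (cases c) (simp only: Un_iff UN_iff mem_Collect_eq case_prod_conv, blast)
    then show ?thesis by blast
  qed
  then have "card ?arr = card (arrangements A R L) + card (\<Union>B \<in> Pow A - {{}}. ?X B)"
    using fin fin_X assms unfolding free
    by (subst card_Un_disjoint[symmetric]) (auto intro: rev_finite_subset)
  also have "card (\<Union>B \<in> Pow A - {{}}. ?X B) = (\<Sum>B \<in> Pow A - {{}}. card (?X B))"
  proof (rule card_UN_disjoint)
    show "\<forall>B \<in> Pow A - {{}}. \<forall>C \<in> Pow A - {{}}. B \<noteq> C \<longrightarrow> ?X B \<inter> ?X C = {}"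
    proof (intro ballI impI)
      fix B C :: "nat set" assume "B \<noteq> C"
      then have "\<not> (B \<in> P \<and> f B = PairedWith D \<and> C \<in> P \<and> f C = PairedWith D)"
        if "(P, f, M) \<in> ?arr" for P f M
        using that unfolding arrangements_def by blast
      then show "?X B \<inter> ?X C = {}" by blast
    qed
  qed (use assms fin_X in auto)
  also have "\<dots> = (\<Sum>B \<in> Pow A - {{}}. card (arrangements (A - B) R L))"
  proof (rule sum.cong[OF refl])
    fix B assume "B \<in> Pow A - {{}}"
    then show "card (?X B) = card (arrangements (A - B) R L)"
      using card_arrangements_paired_block[of B A D "insert D R" L] assms(4) by simp
  qed
  also have "card (arrangements A R L) + \<dots> = (\<Sum>B \<in> Pow A. card (arrangements (A - B) R L))"
    using assms(1) by (subst sum.remove[of "Pow A" "{}"]) auto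
  finally show ?thesis .
qed

text \<open>The set \<open>C\<close> is the partner of \<open>B\<close>; \<open>C = {}\<close> accounts for the arrangements in which \<open>B\<close> is
  unmatched.\<close>

lemma card_arrangements_section_block:
  assumes "finite A" "finite R" "finite L" "B \<noteq> {}" "B \<subseteq> A" "s \<in> L"
  shows "card {(P, f, M) \<in> arrangements A R L. B \<in> P \<and> f B = Section s} =
    (\<Sum>C \<in> Pow (A - B). card (arrangements (A - B - C) R L))"
proof -
  let ?arr = "arrangements A R L"
  let ?Y = "{(P, f, M) \<in> ?arr. B \<in> P \<and> f B = Section s}"
  let ?Single = "{(P, f, M) \<in> ?arr. B \<in> P \<and> f B = Section s \<and> B \<notin> \<Union>M}"
  let ?X = "\<lambda>C. {(P, f, M) \<in> ?arr. B \<in> P \<and> f B = Section s \<and> {B, C} \<in> M}"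
  have fin: "finite ?arr" using assms by (intro finite_arrangements) auto
  then have fin_X: "finite (?X C)" for C by (rule rev_finite_subset) auto
  have partner: "\<exists>C \<in> Pow (A - B) - {{}}. {B, C} \<in> M"
    if arr: "(P, f, M) \<in> ?arr" and "B \<in> P" "B \<in> \<Union>M" for P f M
  proof -
    have M: "section_matching P f M" using arr by (simp add: arrangements_def)
    from \<open>B \<in> \<Union>M\<close> obtain e where e: "e \<in> M" "B \<in> e" by blast
    then obtain B' C' where "e = {B', C'}" "B' \<noteq> C'" "B' \<in> P" "C' \<in> P"
      by (meson section_matchingE[OF M])
    with e have "{B, C'} \<in> M \<and> B \<noteq> C' \<or> {B, B'} \<in> M \<and> B \<noteq> B'"
      by (metis insert_commute insert_iff singletonD)
    with \<open>B' \<in> P\<close> \<open>C' \<in> P\<close> obtain C where C: "{B, C} \<in> M" "C \<in> P" "C \<noteq> B" by metis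
    moreover have "C \<subseteq> A - B" "C \<noteq> {}"
      using C \<open>B \<in> P\<close> arr by (auto simp: arrangements_def partition_on_def disjoint_def)
    ultimately show ?thesis by blast
  qed
  have "?Y \<subseteq> ?Single \<union> (\<Union>C \<in> Pow (A - B) - {{}}. ?X C)"
  proof (rule subsetI)
    fix c assume c: "c \<in> ?Y"
    obtain P f M where c_eq: "c = (P, f, M)" by (cases c)
    show "c \<in> ?Single \<union> (\<Union>C \<in> Pow (A - B) - {{}}. ?X C)"
    proof (cases "B \<in> \<Union>M")
      case True
      then obtain C where C: "C \<in> Pow (A - B) - {{}}" "{B, C} \<in> M"
        using partner[of P f M] c c_eq by auto
      then have "c \<in> ?X C" using c c_eq by simp
      with C(1) show ?thesis by (intro UnI2 UN_I)
    qed (use c c_eq in simp)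
  qed
  moreover have "(\<Union>C \<in> Pow (A - B) - {{}}. ?X C) \<subseteq> ?Y"
    by (rule UN_least) auto
  moreover have "?Single \<subseteq> ?Y" by auto
  ultimately have "?Y = ?Single \<union> (\<Union>C \<in> Pow (A - B) - {{}}. ?X C)"
    by (intro subset_antisym Un_least)
  moreover have "?Single \<inter> (\<Union>C \<in> Pow (A - B) - {{}}. ?X C) = {}"
  proof -
    have "?Single \<inter> ?X C = {}" for C by blast
    then show ?thesis by (simp only: Int_UN_distrib UN_constant) simp
  qed
  moreover have "finite ?Single" using fin by (rule rev_finite_subset) auto
  moreover have "finite (\<Union>C \<in> Pow (A - B) - {{}}. ?X C)"
    using assms(1) fin_X by (intro finite_UN_I) auto
  ultimately have "card ?Y = card ?Single + card (\<Union>C \<in> Pow (A - B) - {{}}. ?X C)"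
    by (simp only: card_Un_disjoint)
  also have "card (\<Union>C \<in> Pow (A - B) - {{}}. ?X C) = (\<Sum>C \<in> Pow (A - B) - {{}}. card (?X C))"
  proof (rule card_UN_disjoint)
    show "\<forall>C \<in> Pow (A - B) - {{}}. \<forall>C' \<in> Pow (A - B) - {{}}. C \<noteq> C' \<longrightarrow> ?X C \<inter> ?X C' = {}"
    proof (intro ballI impI)
      fix C C' :: "nat set" assume "C \<noteq> C'"
      then have "{B, C} \<noteq> {B, C'}" by (auto simp: doubleton_eq_iff)
      then have "\<not> (disjoint M \<and> {B, C} \<in> M \<and> {B, C'} \<in> M)" for M
        by (metis Int_iff disjointD empty_iff insertI1)
      then have "\<not> ((P, f, M) \<in> ?arr \<and> {B, C} \<in> M \<and> {B, C'} \<in> M)" for P f M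
        by (simp add: arrangements_def section_matching_def)
      then show "?X C \<inter> ?X C' = {}" by blast
    qed
  qed (use assms fin_X in auto)
  also have "\<dots> = (\<Sum>C \<in> Pow (A - B) - {{}}. card (arrangements (A - B - C) R L))"
    using assms by (intro sum.cong refl card_arrangements_matched_blocks) auto
  also have "card ?Single = card (arrangements (A - B) R L)"
    using assms by (intro card_arrangements_single_block)
  also have "card (arrangements (A - B) R L) + (\<Sum>C \<in> Pow (A - B) - {{}}. card (arrangements (A - B - C) R L))
      = (\<Sum>C \<in> Pow (A - B). card (arrangements (A - B - C) R L))"
    using assms(1) by (subst sum.remove[of "Pow (A - B)" "{}"]) auto
  finally show ?thesis .
qed

lemma card_arrangements_block:
  assumes "finite A" "finite R" "finite L" "B \<noteq> {}" "B \<subseteq> A"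
  shows "card {(P, f, M) \<in> arrangements A R L. B \<in> P} =
    (\<Sum>D \<in> R. card (arrangements (A - B) (R - {D}) L)) +
    card L * (\<Sum>C \<in> Pow (A - B). card (arrangements (A - B - C) R L))"
proof -
  let ?arr = "arrangements A R L"
  let ?T = "Section ` L \<union> PairedWith ` R"
  let ?X = "\<lambda>p. {(P, f, M) \<in> ?arr. B \<in> P \<and> f B = p}"
  have fin: "finite ?arr" using assms by (intro finite_arrangements) auto
  have "{(P, f, M) \<in> ?arr. B \<in> P} = (\<Union>p \<in> ?T. ?X p)"
  proof (rule subset_antisym)
    have "f B \<in> ?T" if "(P, f, M) \<in> ?arr" "B \<in> P" for P f M
      using that unfolding arrangements_def by blast
    then show "{(P, f, M) \<in> ?arr. B \<in> P} \<subseteq> (\<Union>p \<in> ?T. ?X p)"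
      by fastforce
  qed auto
  also have "card \<dots> = (\<Sum>p \<in> ?T. card (?X p))"
  proof (rule card_UN_disjoint)
    show "\<forall>p \<in> ?T. finite (?X p)" by (intro ballI rev_finite_subset[OF fin]) auto
  qed (use assms in auto)
  also have "\<dots> = (\<Sum>s \<in> L. card (?X (Section s))) + (\<Sum>D \<in> R. card (?X (PairedWith D)))"
    using assms by (subst sum.union_disjoint) (auto simp: sum.reindex inj_on_def)
  also have "\<dots> = (\<Sum>s \<in> L. \<Sum>C \<in> Pow (A - B). card (arrangements (A - B - C) R L)) +
      (\<Sum>D \<in> R. card (arrangements (A - B) (R - {D}) L))"
    using assms by (intro arg_cong2[where f = "(+)"] sum.cong refl
      card_arrangements_section_block card_arrangements_paired_block)
  finally show ?thesis by simp
qed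

text \<open>Here \<open>insert x B\<close> is the block of the new element, so that \<open>B\<close> runs over all subsets of \<open>A\<close>.\<close>

lemma card_arrangements_insert_element:
  assumes "finite A" "finite R" "finite L" "x \<notin> A"
  shows "card (arrangements (insert x A) R L) = (\<Sum>B \<in> Pow A.
    (\<Sum>D \<in> R. card (arrangements (A - B) (R - {D}) L)) +
    card L * (\<Sum>C \<in> Pow (A - B). card (arrangements (A - B - C) R L)))"
proof -
  let ?arr = "arrangements (insert x A) R L"
  let ?X = "\<lambda>B. {(P, f, M) \<in> ?arr. insert x B \<in> P}"
  have fin: "finite ?arr" using assms by (intro finite_arrangements) auto
  have "?arr = (\<Union>B \<in> Pow A. ?X B)"
  proof (rule subset_antisym)
    have "\<exists>B \<in> Pow A. insert x B \<in> P" if P: "partition_on (insert x A) P" for P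
    proof -
      have "\<Union>P = insert x A" using P by (simp add: partition_on_def)
      then obtain E where "E \<in> P" "x \<in> E" by blast
      with \<open>\<Union>P = insert x A\<close> have "E - {x} \<in> Pow A" "insert x (E - {x}) \<in> P"
        by (auto simp: insert_absorb)
      then show ?thesis by blast
    qed
    then have "\<exists>B \<in> Pow A. insert x B \<in> P" if "(P, f, M) \<in> ?arr" for P f M
      using that by (simp add: arrangements_def)
    then show "?arr \<subseteq> (\<Union>B \<in> Pow A. ?X B)" by fastforce
  qed auto
  also have "card \<dots> = (\<Sum>B \<in> Pow A. card (?X B))"
  proof (rule card_UN_disjoint)
    show "\<forall>B \<in> Pow A. \<forall>B' \<in> Pow A. B \<noteq> B' \<longrightarrow> ?X B \<inter> ?X B' = {}"
    proof (intro ballI impI)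
      fix B B' assume "B \<in> Pow A" "B' \<in> Pow A" "B \<noteq> B'"
      then have "insert x B \<noteq> insert x B'"
        using assms(4) by (metis Diff_insert_absorb PowD subsetD)
      then have "\<not> (partition_on (insert x A) P \<and> insert x B \<in> P \<and> insert x B' \<in> P)" for P
        by (metis Int_iff disjointD empty_iff insertI1 partition_onD2)
      then have "\<not> ((P, f, M) \<in> ?arr \<and> insert x B \<in> P \<and> insert x B' \<in> P)" for P f M
        by (simp add: arrangements_def)
      then show "?X B \<inter> ?X B' = {}" by blast
    qed
    show "\<forall>B \<in> Pow A. finite (?X B)" by (intro ballI rev_finite_subset[OF fin]) auto
  qed (use assms in auto)
  also have "\<dots> = (\<Sum>B \<in> Pow A.
    (\<Sum>D \<in> R. card (arrangements (A - B) (R - {D}) L)) +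
    card L * (\<Sum>C \<in> Pow (A - B). card (arrangements (A - B - C) R L)))"
  proof (rule sum.cong[OF refl])
    fix B assume "B \<in> Pow A"
    then have "insert x A - insert x B = A - B" using assms(4) by auto
    moreover have "insert x B \<subseteq> insert x A" using \<open>B \<in> Pow A\<close> by blast
    ultimately show "card (?X B) = (\<Sum>D \<in> R. card (arrangements (A - B) (R - {D}) L)) +
      card L * (\<Sum>C \<in> Pow (A - B). card (arrangements (A - B - C) R L))"
      using card_arrangements_block[of "insert x A" R L "insert x B"] assms by simp
  qed
  finally show ?thesis .
qed

text \<open>The subset sums for the block of \<open>x\<close> are those that arise from adding labels: returning the used
  label \<open>E\<close> to \<open>R - {E}\<close> in the paired case, and adding two labels \<open>D\<close> and \<open>D'\<close> to \<open>R\<close> in the section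
  case, one for the rest of the block of \<open>x\<close> and one for its partner.\<close>

lemma card_arrangements_recurrence:
  assumes "finite A" "finite R" "finite L" "x \<notin> A" "D \<notin> R" "D' \<notin> insert D R"
  shows "card (arrangements (insert x A) R L) =
    card R * card (arrangements A R L) + card L * card (arrangements A (insert D' (insert D R)) L)"
proof -
  have "(\<Sum>B \<in> Pow A. \<Sum>E \<in> R. card (arrangements (A - B) (R - {E}) L)) =
      (\<Sum>E \<in> R. \<Sum>B \<in> Pow A. card (arrangements (A - B) (R - {E}) L))"
    by (rule sum.swap)
  also have "\<dots> = (\<Sum>E \<in> R. card (arrangements A R L))"
  proof (rule sum.cong[OF refl])
    fix E assume "E \<in> R"
    then show "(\<Sum>B \<in> Pow A. card (arrangements (A - B) (R - {E}) L)) = card (arrangements A R L)"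
      using card_arrangements_insert_label[of A "R - {E}" L E] assms by (simp add: insert_absorb)
  qed
  finally have paired: "(\<Sum>B \<in> Pow A. \<Sum>E \<in> R. card (arrangements (A - B) (R - {E}) L)) =
      card R * card (arrangements A R L)" by simp
  have "(\<Sum>B \<in> Pow A. \<Sum>C \<in> Pow (A - B). card (arrangements (A - B - C) R L)) =
      (\<Sum>B \<in> Pow A. card (arrangements (A - B) (insert D R) L))"
    using assms by (simp add: card_arrangements_insert_label)
  also have "\<dots> = card (arrangements A (insert D' (insert D R)) L)"
    using assms by (intro card_arrangements_insert_label[symmetric]) auto
  finally show ?thesis
    using assms paired
    by (simp add: card_arrangements_insert_element sum.distrib flip: sum_distrib_left)
qed

lemma card_arrangements:
  assumes "finite A" "finite R" "finite L"
  shows "real (card (arrangements A R L)) =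
    (\<Sum>k = 0..card A. r_whitney2 2 (card R) (card A) k * real (card L) ^ k)"
  using assms
proof (induction A arbitrary: R rule: finite_induct)
  case empty
  then show ?case by (simp add: arrangements_empty r_whitney2_0_0)
next
  case (insert x A)
  \<comment> \<open>The recurrence needs two fresh labels.\<close>
  have "infinite (UNIV :: nat set set)" by (simp add: Finite_Set.finite_set)
  then obtain D D' where D: "D \<notin> R" "D' \<notin> insert D R"
    using insert.prems by (metis ex_new_if_finite finite.insertI)
  then have "card (insert D' (insert D R)) = card R + 2" using insert.prems by simp
  then have "real (card (arrangements (insert x A) R L)) =
      real (card R) * (\<Sum>k = 0..card A. r_whitney2 2 (card R) (card A) k * real (card L) ^ k) +
      real (card L) * (\<Sum>k = 0..card A. r_whitney2 2 (card R + 2) (card A) k * real (card L) ^ k)"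
    using insert D by (simp add: card_arrangements_recurrence[OF _ _ _ _ D])
  also have "\<dots> = (\<Sum>k = 0..Suc (card A).
      r_whitney2 2 (card R) (Suc (card A)) k * real (card L) ^ k)"
    by (rule r_whitney2_polynomial_Suc[symmetric]) simp
  finally show ?case
    unfolding card_insert_disjoint[OF insert.hyps(1,2)] .
qed

lemma card_singleton_blocks: "card (singleton_blocks r) = r"
  by (simp add: singleton_blocks_def card_image)

theorem theorem4p7:
  fixes n r l :: nat
  assumes "r \<ge> 1" and "l \<ge> 1"
  shows "real (B_tilde r l n) =
    (\<Sum>k = 0..n. \<Sum>i = k..n. real (n choose i) * r_whitney2 2 (r - 1) i k * real l ^ k)"
proof -
  have "finite (singleton_blocks r)" by (simp add: singleton_blocks_def)
  then have "real (B_tilde r l n) = (\<Sum>k = 0..n. r_whitney2 2 r n k * real l ^ k)"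
    by (simp add: B_tilde_def configurations_eq_arrangements card_arrangements card_singleton_blocks)
  also have "\<dots> = (\<Sum>k = 0..n. \<Sum>i = k..n. real (n choose i) * r_whitney2 2 (r - 1) i k * real l ^ k)"
  proof (rule sum.cong[OF refl])
    fix k
    have "r_whitney2 2 r n k = (\<Sum>i = 0..n. real (n choose i) * r_whitney2 2 (r - 1) i k)"
      using r_whitney2_shift[of 2 "r - 1" n k] assms(1) by simp
    also have "\<dots> = (\<Sum>i = k..n. real (n choose i) * r_whitney2 2 (r - 1) i k)"
      by (rule sum.mono_neutral_right) (auto simp: r_whitney2_eq_0)
    finally show "r_whitney2 2 r n k * real l ^ k =
        (\<Sum>i = k..n. real (n choose i) * r_whitney2 2 (r - 1) i k * real l ^ k)"
      by (simp add: sum_distrib_right)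
  qed
  finally show ?thesis .
qed

end
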